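(* For every $p_0\in\mathbb{N}\setminus P$ the series \[ s(p_0)=\sum_{i=1}^\infty \frac{1}{p_i(p_0)} \] converges, where $p_i(p_0)$ denotes the $i$-th element of the Eratosthenes ray of base $p_0$.
   Context: $P$ is the set of primes and $\pi^{-1}(n)$ the $n$-th prime. For a natural number $p_0$, define $p_{k+1}(p_0)=\pi^{-1}(p_k(p_0))$ for $k\ge0$ with $p_0(p_0)=p_0$; the Eratosthenes ray of base $p_0$ is $\{p_i(p_0): i\ge1\}$. *)

theory Defs
  imports Complex_Main "HOL-Library.Infinite_Set" "HOL-Computational_Algebra.Primes"
begin

text \<open>
  The \<open>n\<close>-th prime, counted from 1 (so that \<open>nth_prime 1 = 2\<close>), whereas
  \<^const>\<open>enumerate\<close> counts from 0. The value at \<open>n = 0\<close> has no meaning.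
\<close>
definition nth_prime :: "nat \<Rightarrow> nat" where
  "nth_prime n = enumerate {p :: nat. prime p} (n - 1)"

text \<open>
  \<open>eratosthenes_seq p0 i\<close> is the number \<open>p\<^sub>i(p\<^sub>0)\<close>; the Eratosthenes ray of base \<open>p\<^sub>0\<close>
  consists of the terms with \<open>i \<ge> 1\<close>, so the base itself is not part of it.
\<close>
primrec eratosthenes_seq :: "nat \<Rightarrow> nat \<Rightarrow> nat" where
  "eratosthenes_seq p0 0 = p0"
| "eratosthenes_seq p0 (Suc k) = nth_prime (eratosthenes_seq p0 k)"

end

theory Submission
  imports Defs
begin

text \<open>Primes above 2 are odd, hence at least 2 apart, so the n-th prime is at least 2n - 1
  (\<open>nth_prime_ge\<close>). Iterating this bound from a first ray term of at least 2 gives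
  exponential growth (\<open>eratosthenes_seq_Suc_ge\<close>), and the reciprocals are dominated by
  a geometric series.\<close>

lemma prime_enumerate_primes: "prime (enumerate {p :: nat. prime p} k)"
  using enumerate_in_set[OF primes_infinite, of k] by simp

lemma enumerate_primes_step:
  "enumerate {p :: nat. prime p} k < enumerate {p :: nat. prime p} (Suc k)"
  by (rule enumerate_step[OF primes_infinite])

lemma primes_gap_ge_2:
  fixes p q :: nat
  assumes "prime p" "prime q" "2 < p" "p < q"
  shows "p + 2 \<le> q"
proof -
  have "odd p" "odd q"
    using assms prime_odd_nat[of p] prime_odd_nat[of q] by auto
  with \<open>p < q\<close> show ?thesis by presburger
qed

text \<open>Index \<open>Suc k\<close> skips the prime 2, whose gap to 3 is only 1; from 3 on every
  gap is at least 2.\<close>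

lemma enumerate_primes_Suc_ge: "2 * k + 3 \<le> enumerate {p :: nat. prime p} (Suc k)"
proof (induction k)
  case 0
  show ?case
    using enumerate_primes_step[of 0] prime_ge_2_nat[OF prime_enumerate_primes[of 0]] by linarith
next
  case (Suc k)
  have "2 * Suc k + 3 = 2 * k + 3 + 2"
    by simp
  also have "\<dots> \<le> enumerate {p :: nat. prime p} (Suc k) + 2"
    using Suc.IH by (rule add_right_mono)
  also have "\<dots> \<le> enumerate {p. prime p} (Suc (Suc k))"
  proof (rule primes_gap_ge_2[OF prime_enumerate_primes prime_enumerate_primes])
    show "2 < enumerate {p :: nat. prime p} (Suc k)"
      using Suc.IH by linarith
  qed (rule enumerate_primes_step)
  finally show ?case .
qed

lemma nth_prime_ge_2: "2 \<le> nth_prime n"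
  unfolding nth_prime_def by (rule prime_ge_2_nat[OF prime_enumerate_primes])

text \<open>The form with \<open>+ 1\<close> avoids truncated subtraction. For
  \<open>n \<le> 1\<close> it suffices that every value is a prime.\<close>

lemma nth_prime_ge: "2 * n \<le> nth_prime n + 1"
proof (cases "n \<le> 1")
  case True
  with nth_prime_ge_2[of n] show ?thesis by linarith
next
  case False
  \<comment> \<open>With \<open>k = n - 2\<close>, the bound \<open>2 * k + 3\<close> becomes 2n -
    1.\<close>
  then have "n - 1 = Suc (n - 2)" by simp
  then show ?thesis
    using enumerate_primes_Suc_ge[of "n - 2"] False
    by (simp add: nth_prime_def)
qed

text \<open>The distance to the fixed point 1 of \<open>n \<mapsto> 2 * n - 1\<close> at least doubles in each step.\<close>
lemma eratosthenes_seq_Suc_ge: "2 ^ i + 1 \<le> eratosthenes_seq p0 (Suc i)"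
proof (induction i)
  case 0
  show ?case using nth_prime_ge_2[of p0] by simp
next
  case (Suc i)
  then show ?case
    using nth_prime_ge[of "eratosthenes_seq p0 (Suc i)"] by simp
qed

theorem theorem2:
  fixes p0 :: nat
  assumes "p0 \<ge> 1" and "\<not> prime p0"
  shows "summable (\<lambda>i. 1 / real (eratosthenes_seq p0 (Suc i)))"
proof (rule summable_comparison_test')
  show "summable (\<lambda>i. (1 / 2 :: real) ^ i)"
    by (rule summable_geometric) simp
  fix i :: nat
  have "real (2 ^ i) \<le> real (eratosthenes_seq p0 (Suc i))"
    by (rule of_nat_mono, rule order_trans[OF le_add1 eratosthenes_seq_Suc_ge])
  then have "1 / real (eratosthenes_seq p0 (Suc i)) \<le> 1 / real (2 ^ i)"
    \<comment> \<open>The bound by 2 makes the denominator positive.\<close>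
    using nth_prime_ge_2[of "eratosthenes_seq p0 i"] by (intro divide_left_mono mult_pos_pos) auto
  then show "norm (1 / real (eratosthenes_seq p0 (Suc i))) \<le> (1 / 2) ^ i"
    by (simp add: power_one_over)
qed

end
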